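(* Let $d\ge 3$ and let $h$ be a $d$-uniform hypergraph that is a preimage of an ambiguous graph. Then $d-1-\frac{1}{m(h)}\ge\frac{2d-4}{2d-1}$.
   Context: For a $d$-uniform hypergraph $H$, $\mathrm{Proj}(H)$ is the graph on the same vertex set with $\{i,j\}$ an edge iff some hyperedge contains $\{i,j\}$; $H$ is a preimage of a graph $G$ if $\mathrm{Proj}(H)=G$. A minimal preimage of $G$ is a preimage with the minimum number of hyperedges; $G$ is ambiguous if it has at least two distinct minimal preimages. For a hypergraph $K$, $\alpha(K)=e(K)/v(K)$ (hyperedges over vertices) and $m(H)=\max_{K\subseteq H}\alpha(K)$ over subhypergraphs $K$ of $H$. *)

theory Defs
  imports Complex_Main
begin

text \<open>Vertices are drawn from an arbitrary type and the vertex set is explicit, so isolated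
  vertices are allowed. Edges form a set, so there are no multiple hyperedges. Graphs are the
  case of 2-uniform hypergraphs.\<close>

record 'a hypergraph =
  hverts :: "'a set"
  hedges :: "'a set set"

definition uniform_hypergraph :: "nat \<Rightarrow> 'a hypergraph \<Rightarrow> bool" where
  "uniform_hypergraph d H \<longleftrightarrow>
     finite (hverts H) \<and> (\<forall>e\<in>hedges H. e \<subseteq> hverts H \<and> card e = d)"

abbreviation simple_graph :: "'a hypergraph \<Rightarrow> bool" where
  "simple_graph G \<equiv> uniform_hypergraph 2 G"

definition Proj :: "'a hypergraph \<Rightarrow> 'a hypergraph" where
  "Proj H = \<lparr> hverts = hverts H,
              hedges = {{i, j} | i j. i \<noteq> j \<and> (\<exists>e\<in>hedges H. {i, j} \<subseteq> e)} \<rparr>"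

lemma simple_graph_Proj:
  assumes "uniform_hypergraph d H"
  shows "simple_graph (Proj H)"
  using assms by (fastforce simp: uniform_hypergraph_def Proj_def)

definition preimage :: "nat \<Rightarrow> 'a hypergraph \<Rightarrow> 'a hypergraph \<Rightarrow> bool" where
  "preimage d G H \<longleftrightarrow> uniform_hypergraph d H \<and> Proj H = G"

definition minimal_preimage :: "nat \<Rightarrow> 'a hypergraph \<Rightarrow> 'a hypergraph \<Rightarrow> bool" where
  "minimal_preimage d G H \<longleftrightarrow>
     preimage d G H \<and> (\<forall>H'. preimage d G H' \<longrightarrow> card (hedges H) \<le> card (hedges H'))"

definition ambiguous :: "nat \<Rightarrow> 'a hypergraph \<Rightarrow> bool" where
  "ambiguous d G \<longleftrightarrow>
     (\<exists>H1 H2. minimal_preimage d G H1 \<and> minimal_preimage d G H2 \<and> H1 \<noteq> H2)"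

definition subhypergraph :: "'a hypergraph \<Rightarrow> 'a hypergraph \<Rightarrow> bool" where
  "subhypergraph K H \<longleftrightarrow>
     hverts K \<subseteq> hverts H \<and> hedges K \<subseteq> hedges H \<and> (\<forall>e\<in>hedges K. e \<subseteq> hverts K)"

definition edge_density :: "'a hypergraph \<Rightarrow> real" where
  "edge_density K = real (card (hedges K)) / real (card (hverts K))"

text \<open>The density is a quotient by the number of vertices, so the maximum ranges over
  subhypergraphs with at least one vertex.\<close>

definition max_density :: "'a hypergraph \<Rightarrow> real" where
  "max_density H = Max {edge_density K | K. subhypergraph K H \<and> hverts K \<noteq> {}}"

text \<open>For a finite hypergraph with at least one vertex this maximum is over a finite nonempty
  set, so it is attained.\<close>

lemma max_density_set:
  assumes "uniform_hypergraph d H" "hverts H \<noteq> {}"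
  shows "finite {edge_density K | K. subhypergraph K H \<and> hverts K \<noteq> {}}" (is "finite ?S")
    and "{edge_density K | K. subhypergraph K H \<and> hverts K \<noteq> {}} \<noteq> {}"
proof -
  have fV: "finite (hverts H)"
    using assms(1) by (simp add: uniform_hypergraph_def)
  have "hedges H \<subseteq> Pow (hverts H)"
    using assms(1) by (auto simp: uniform_hypergraph_def)
  with fV have fE: "finite (hedges H)"
    by (meson finite_Pow_iff finite_subset)
  have "?S \<subseteq> (\<lambda>(V, E). real (card E) / real (card V)) ` (Pow (hverts H) \<times> Pow (hedges H))"
    by (force simp: edge_density_def subhypergraph_def)
  then show "finite ?S"
    using fV fE by (meson finite_Pow_iff finite_SigmaI finite_imageI finite_subset)
  have "subhypergraph H H"
    using assms(1) by (simp add: subhypergraph_def uniform_hypergraph_def)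
  then show "?S \<noteq> {}"
    using assms(2) by blast
qed

end

theory Submission
  imports Defs
begin

text \<open>Put \<open>c = (2d\<^sup>2 - 5d + 5) / (2d - 1)\<close>; the claim says that some subhypergraph of \<open>h\<close> has at
  most \<open>c\<close> times as many vertices as hyperedges. Shrink \<open>h\<close> to an irredundant preimage \<open>P\<close> and
  compare it with a minimal preimage \<open>Q \<noteq> P\<close>. Let \<open>A = P - Q\<close>, \<open>C = Q - P\<close> and \<open>B = P \<inter> Q\<close>, so
  that \<open>|C| \<le> |A|\<close>. Let \<open>W\<close> be the set of vertices of \<open>E = A \<union> C\<close>, and let \<open>B'\<close> consist of the
  \<open>b \<in> B\<close> with at least two vertices in \<open>W\<close>. The hyperedges \<open>A \<union> B'\<close> on the vertex set
  \<open>W \<union> \<Union>B'\<close> are dense enough. Since \<open>|A| \<ge> |E| / 2\<close> this is a discharging statement. In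
  multiples of \<open>1 / (2 (2d - 1))\<close>, every edge of \<open>E\<close> demands \<open>4d - 5\<close>, a vertex of degree \<open>k\<close> in
  \<open>E\<close> supplies \<open>(k - 2) (2d - 1)\<close>, and a \<open>b \<in> B'\<close> supplies \<open>2 (2d - 1) (|b \<inter> W| - 2) + 6\<close>,
  which it distributes over the pairs that it shares with edges of \<open>E\<close>. A pair contained in
  exactly one edge of \<open>E\<close> is covered by both preimages, hence by \<open>B\<close>, and it pays to its edge.
  The extremal configuration has \<open>A = {S \<union> {u}}\<close> and \<open>C = {S \<union> {v}}\<close>, with all pairs at \<open>u\<close> and
  at \<open>v\<close> covered by distinct pendant hyperedges.\<close>

section \<open>Setting: two families of hyperedges that cover the same pairs\<close>

lemma real_choose_2: "real (n choose 2) = real n * (real n - 1) / 2"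
  by (induction n) (simp_all add: numeral_2_eq_2 field_simps)

text \<open>The two preimages are \<open>B \<union> A\<close> and \<open>B \<union> C\<close>. The
  hypotheses are symmetric in \<open>A\<close> and \<open>C\<close>; their sizes are compared only
  in \<open>dense_part\<close>. \<open>irredundant\<close> serves to exclude an edge all of whose
  vertices have degree 1.\<close>

locale cover_pair =
  fixes d :: nat and A B C :: "'a set set"
  assumes d3: "3 \<le> d"
    and fin: "finite A" "finite B" "finite C"
    and card_edge: "\<And>g. g \<in> A \<union> B \<union> C \<Longrightarrow> card g = d"
    and disj: "A \<inter> C = {}" "B \<inter> (A \<union> C) = {}"
    and covA: "\<And>a x y. \<lbrakk>a \<in> A; x \<in> a; y \<in> a; x \<noteq> y\<rbrakk> \<Longrightarrow> \<exists>g\<in>B \<union> C. x \<in> g \<and> y \<in> g"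
    and covC: "\<And>a x y. \<lbrakk>a \<in> C; x \<in> a; y \<in> a; x \<noteq> y\<rbrakk> \<Longrightarrow> \<exists>g\<in>B \<union> A. x \<in> g \<and> y \<in> g"
    and irredundant: "\<And>a. a \<in> A \<union> C \<Longrightarrow>
      \<exists>x\<in>a. \<exists>y\<in>a. x \<noteq> y \<and> \<not> (\<exists>b\<in>B. x \<in> b \<and> y \<in> b)"
begin

definition E where "E = A \<union> C"
definition W where "W = \<Union>E"
definition deg where "deg v = card {g \<in> E. v \<in> g}"
definition shared_pairs where
  "shared_pairs = {p. card p = 2 \<and> (\<exists>g\<in>E. p \<subseteq> g) \<and> (\<exists>b\<in>B. p \<subseteq> b)}"
definition own_pairs where
  "own_pairs a = {p. card p = 2 \<and> p \<subseteq> a \<and> (\<forall>g\<in>E. p \<subseteq> g \<longrightarrow> g = a)}"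
text \<open>An equal share per vertex of the demand \<open>4 * d - 5\<close> of an edge.\<close>

definition q :: real where "q = (4 * real d - 5) / real d"

text \<open>A pair pays 6 if the hyperedges in \<open>B\<close> can afford it. Only a hyperedge inside \<open>W\<close> may be
  unable to, for \<open>d < 5\<close>, and only if all its pairs are shared; then it has no vertex of degree 1.
  The smaller amount \<open>2 * q\<close> is \<open>q\<close> per endpoint: for \<open>d \<le> 5\<close> a vertex of degree at least 3 pays \<open>q\<close>
  to each edge in which it has no own pair.\<close>

definition wt :: "'a set \<Rightarrow> real" where
  "wt p = (if 6 \<le> d \<or> (\<exists>u\<in>p. deg u = 1) then 6 else 2 * q)"

text \<open>A vertex of degree \<open>k\<close> splits its supply
  \<open>(k - 2) * (2 * d - 1)\<close> among its \<open>k\<close> edges. At degree 1 this is a debt,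
  to be settled by own pairs of the edge. For \<open>6 \<le> d\<close> the share at degree 3 is used
  for all larger degrees.\<close>

definition charge :: "'a \<Rightarrow> 'a set \<Rightarrow> real" where
  "charge x a =
     (if deg x = 1 then - (2 * real d - 1)
      else if deg x = 2 then 0
      else if 6 \<le> d then (2 * real d - 1) / 3
      else if x \<in> \<Union>(own_pairs a) then 0 else q)"

section \<open>Degrees, own pairs and shared pairs\<close>

lemma finE: "finite E"
  by (simp add: E_def fin)

lemma card_E: "g \<in> E \<Longrightarrow> card g = d"
  using card_edge by (auto simp: E_def)

lemma fin_edge: "g \<in> E \<or> g \<in> B \<Longrightarrow> finite g"
  using card_E card_edge[of g] d3 by (auto intro: card_ge_0_finite)

lemma finW: "finite W"
  using finE fin_edge by (auto simp: W_def)

lemma deg_pos: "g \<in> E \<Longrightarrow> x \<in> g \<Longrightarrow> 0 < deg x"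
  using finE by (auto simp: deg_def card_gt_0_iff)

lemma deg_1_unique: "deg x = 1 \<Longrightarrow> g \<in> E \<Longrightarrow> x \<in> g \<Longrightarrow> g' \<in> E \<Longrightarrow> x \<in> g' \<Longrightarrow> g' = g"
  unfolding deg_def by (metis (mono_tags, lifting) card_1_singletonE mem_Collect_eq singletonD)

lemma deg_2_other:
  assumes "deg x = 2" "g \<in> E" "x \<in> g"
  obtains g' where "g' \<in> E" "x \<in> g'" "g' \<noteq> g" "{e \<in> E. x \<in> e} = {g, g'}"
proof -
  have "g \<in> {e \<in> E. x \<in> e}" using assms by simp
  moreover have "card {e \<in> E. x \<in> e} = 2" using assms(1) by (simp add: deg_def)
  moreover then obtain u v where "{e \<in> E. x \<in> e} = {u, v}" "u \<noteq> v"
    unfolding card_2_iff by metis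
  ultimately obtain g' where "{e \<in> E. x \<in> e} = {g, g'}" "g' \<noteq> g"
    by (metis insert_commute insert_iff singletonD)
  then show ?thesis using that[of g'] by blast
qed

lemma edge_diff: "g \<in> E \<union> B \<Longrightarrow> g' \<in> E \<union> B \<Longrightarrow> g \<noteq> g' \<Longrightarrow> \<exists>y. y \<in> g \<and> y \<notin> g'"
  using card_subset_eq[of g' g] fin_edge[of g'] card_E card_edge by (auto simp: subset_eq)

lemma fin_shared: "finite shared_pairs"
proof (rule finite_subset)
  show "shared_pairs \<subseteq> Pow W" by (auto simp: shared_pairs_def W_def)
qed (simp add: finW)

lemma fin_own: "a \<in> E \<Longrightarrow> finite (own_pairs a)"
  by (rule finite_subset[of _ "Pow a"]) (auto simp: own_pairs_def fin_edge)

text \<open>The other preimage covers the pair as well. It cannot do so by a hyperedge of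
  \<open>E\<close>, which would be a second edge of \<open>E\<close> through the pair, so it does by
  one of \<open>B\<close>.\<close>

lemma own_sub_shared:
  assumes "a \<in> E"
  shows "own_pairs a \<subseteq> shared_pairs"
proof
  fix p assume p: "p \<in> own_pairs a"
  then obtain x y where xy: "p = {x, y}" "x \<noteq> y"
    by (auto simp: own_pairs_def card_2_iff)
  have sub: "p \<subseteq> a" and un: "\<And>g. g \<in> E \<Longrightarrow> p \<subseteq> g \<Longrightarrow> g = a"
    using p by (auto simp: own_pairs_def)
  have "\<exists>b\<in>B. p \<subseteq> b"
  proof (cases "a \<in> A")
    case True
    then obtain g where "g \<in> B \<union> C" "x \<in> g" "y \<in> g" using covA[of a x y] sub xy by auto
    then show ?thesis using un[of g] True disj xy by (auto simp: E_def)
  next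
    case False
    then have "a \<in> C" using assms by (simp add: E_def)
    moreover then obtain g where "g \<in> B \<union> A" "x \<in> g" "y \<in> g" using covC[of a x y] sub xy by auto
    ultimately show ?thesis using un[of g] disj xy by (auto simp: E_def)
  qed
  then show "p \<in> shared_pairs" using p assms by (auto simp: shared_pairs_def own_pairs_def)
qed

lemma own_disjoint: "a \<in> E \<Longrightarrow> a' \<in> E \<Longrightarrow> a \<noteq> a' \<Longrightarrow> own_pairs a \<inter> own_pairs a' = {}"
  by (auto simp: own_pairs_def)

lemma deg_1_own:
  assumes "a \<in> E" "x \<in> a" "deg x = 1" "y \<in> a" "x \<noteq> y"
  shows "{x, y} \<in> own_pairs a"
proof -
  have "g = a" if "g \<in> E" "{x, y} \<subseteq> g" for g
    using deg_1_unique[OF assms(3,1,2)] that by blast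
  moreover have "card {x, y} = 2" "{x, y} \<subseteq> a" using assms by simp_all
  ultimately show ?thesis unfolding own_pairs_def by blast
qed

lemma deg_2_own:
  assumes "{e \<in> E. x \<in> e} = {a, g}" "y \<in> a" "y \<notin> g"
  shows "{x, y} \<in> own_pairs a"
proof -
  have mem: "e \<in> E \<and> x \<in> e \<longleftrightarrow> e = a \<or> e = g" for e
    using assms(1) by (metis (mono_tags, lifting) insert_iff mem_Collect_eq singletonD)
  then have "x \<in> a" "x \<noteq> y" using assms by blast+
  then have "card {x, y} = 2" "{x, y} \<subseteq> a" using assms by simp_all
  moreover have "e = a" if "e \<in> E" "{x, y} \<subseteq> e" for e
    using mem[of e] that assms(3) by blast
  ultimately show ?thesis unfolding own_pairs_def by blast
qed

text \<open>For small \<open>d\<close>, a vertex of degree 3 needs this pair to pay \<open>q\<close> to each of its three edges.\<close>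

lemma deg_3_shared:
  assumes "x \<in> W" "deg x \<le> 3"
  shows "\<exists>p\<in>shared_pairs. x \<in> p"
proof -
  \<comment> \<open>\<open>X\<close> and \<open>Y\<close> are \<open>A\<close> and \<open>C\<close>
    in either order. As at most one edge of \<open>Y\<close> passes through \<open>x\<close>, some
    \<open>y\<close> in \<open>a\<close> avoids it; then \<open>B \<union> Y\<close> can cover
    \<open>{x, y}\<close> only by \<open>B\<close>.\<close>
  have half: "\<exists>p\<in>shared_pairs. x \<in> p"
    if a: "a \<in> X" "x \<in> a" and le: "card {e \<in> Y. x \<in> e} \<le> 1"
      and XY: "X \<subseteq> E" "Y \<subseteq> E" "X \<inter> Y = {}"
      and cov: "\<And>y. y \<in> a \<Longrightarrow> x \<noteq> y \<Longrightarrow> \<exists>g\<in>B \<union> Y. x \<in> g \<and> y \<in> g" for a X Y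
  proof -
    have finY: "finite {e \<in> Y. x \<in> e}" using XY finE by (simp add: finite_subset)
    obtain y where y: "y \<in> a" "y \<noteq> x" "\<And>e. e \<in> Y \<Longrightarrow> x \<in> e \<Longrightarrow> y \<notin> e"
    proof (cases "\<exists>e\<in>Y. x \<in> e")
      case True
      then obtain e where e: "e \<in> Y" "x \<in> e" by blast
      then have "{e \<in> Y. x \<in> e} = {e}"
        using le finY by (intro card_seteq[symmetric]) auto
      moreover obtain y where "y \<in> a" "y \<notin> e"
        using edge_diff[of a e] a e XY by blast
      ultimately show ?thesis using that[of y] e by blast
    next
      case False
      have "card a = d" using card_E a XY by blast
      then have "\<not> a \<subseteq> {x}" using d3 card_mono[of "{x}" a] by auto
      then show ?thesis using that False by blast
    qed
    then obtain b where "b \<in> B" "x \<in> b" "y \<in> b" using cov[of y] by blast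
    then have "{x, y} \<in> shared_pairs"
      using y a XY by (auto simp: shared_pairs_def)
    then show ?thesis by blast
  qed
  have split: "deg x = card {e \<in> A. x \<in> e} + card {e \<in> C. x \<in> e}"
    unfolding deg_def E_def
    by (subst card_Un_disjoint[symmetric]) (use fin disj in \<open>auto intro: arg_cong[of _ _ card]\<close>)
  obtain g where g: "g \<in> E" "x \<in> g" using assms by (auto simp: W_def)
  have c: "{e \<in> X. x \<in> e} \<noteq> {} \<Longrightarrow> \<exists>a\<in>X. x \<in> a" for X by blast
  consider "card {e \<in> C. x \<in> e} \<le> 1" "\<exists>a\<in>A. x \<in> a" | "card {e \<in> A. x \<in> e} \<le> 1" "\<exists>a\<in>C. x \<in> a"
  proof -
    have "card {e \<in> A. x \<in> e} = 0 \<or> (\<exists>a\<in>A. x \<in> a)" "card {e \<in> C. x \<in> e} = 0 \<or> (\<exists>a\<in>C. x \<in> a)"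
      by (auto simp: card_eq_0_iff)
    moreover have "(\<exists>a\<in>A. x \<in> a) \<or> (\<exists>a\<in>C. x \<in> a)" using g by (auto simp: E_def)
    ultimately show ?thesis using that split assms(2) by linarith
  qed
  then show ?thesis
  proof cases
    case 1
    then obtain a where "a \<in> A" "x \<in> a" by blast
    then show ?thesis using half[of a A C] 1 disj covA[of a x] by (auto simp: E_def)
  next
    case 2
    then obtain a where "a \<in> C" "x \<in> a" by blast
    then show ?thesis using half[of a C A] 2 disj covC[of a x] by (auto simp: E_def)
  qed
qed

section \<open>Local balance at vertices, at edges of \<open>E\<close> and at hyperedges of
  \<open>B\<close>\<close>

lemma q_bounds: "0 < q" "2 * q \<le> 2 * real d - 1" "q * real d = 4 * real d - 5" "d \<le> 5 \<Longrightarrow> q \<le> 3"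
proof -
  \<comment> \<open>This is \<open>2 * q \<le> 2 * d - 1\<close> multiplied by
    \<open>d\<close>.\<close>
  have "0 \<le> (2 * real d - 5) * (real d - 2)" using d3 by (intro mult_nonneg_nonneg) auto
  then show "2 * q \<le> 2 * real d - 1" using d3 by (simp add: q_def field_simps)
qed (use d3 in \<open>auto simp: q_def field_simps\<close>)

lemma wt_bounds: "0 < wt p" "wt p \<le> 6" "d \<le> 5 \<Longrightarrow> 2 * q \<le> wt p"
  using q_bounds by (auto simp: wt_def not_le)

lemma charge_nonneg: "deg x \<noteq> 1 \<Longrightarrow> 0 \<le> charge x a"
  using q_bounds d3 by (auto simp: charge_def)

text \<open>The supply suffices for \<open>6 \<le> d\<close> because
  \<open>k / 3 \<le> k - 2\<close> when \<open>k \<ge> 3\<close>, and for degree at least 4 because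
  \<open>k / 2 \<le> k - 2\<close> and \<open>2 * q \<le> 2 * d - 1\<close>. At degree 3 with
  \<open>d < 6\<close> it pays \<open>q\<close> twice, against up to three claims. Either an own
  pair at \<open>x\<close> cancels a claim, or the pair from \<open>deg_3_shared\<close> is nobody's
  own pair and contributes \<open>q\<close>; the last summand collects these contributions.\<close>

lemma vertex_charge:
  assumes "x \<in> W"
  shows "(\<Sum>a\<in>{a \<in> E. x \<in> a}. charge x a) \<le>
     (real (deg x) - 2) * (2 * real d - 1) +
     (if 6 \<le> d then 0 else q) * card {p \<in> shared_pairs - \<Union>(own_pairs ` E). x \<in> p}"
     (is "?L \<le> ?M + ?s * real ?n")
proof -
  have finx: "finite {a \<in> E. x \<in> a}" using finE by simp
  have d0: "0 < deg x" using assms deg_pos by (auto simp: W_def)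
  have s: "0 \<le> ?s * real ?n" using q_bounds by simp
  consider "deg x = 1" | "deg x = 2" | "3 \<le> deg x" "6 \<le> d"
    | "deg x = 3" "d < 6" | "4 \<le> deg x" "d < 6" using d0 by linarith
  then show ?thesis
  proof cases
    case 1
    have "?L = - (2 * real d - 1)" using 1 by (simp add: charge_def deg_def[symmetric])
    then show ?thesis using 1 s by simp
  next
    case 2
    have "?L = 0" using 2 by (simp add: charge_def)
    then show ?thesis using 2 s by simp
  next
    case 3
    have "?L = deg x * ((2 * real d - 1) / 3)" using 3 by (simp add: charge_def deg_def[symmetric])
    also have "\<dots> = (deg x / 3) * (2 * real d - 1)" by simp
    also have "\<dots> \<le> ?M" using 3 d3 by (intro mult_right_mono) auto
    finally show ?thesis using s by simp
  next
    case 4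
    have le: "charge x a \<le> q" for a using 4 q_bounds by (simp add: charge_def)
    show ?thesis
    proof (cases "\<exists>a\<in>E. x \<in> \<Union>(own_pairs a)")
      case True
      then obtain a where a: "a \<in> E" "x \<in> \<Union>(own_pairs a)" by blast
      then have ax: "a \<in> {a \<in> E. x \<in> a}" by (auto simp: own_pairs_def)
      have "?L = charge x a + (\<Sum>a\<in>{a \<in> E. x \<in> a} - {a}. charge x a)"
        using ax finx by (rule sum.remove[rotated])
      also have "charge x a = 0" using a 4 by (simp add: charge_def)
      also have "(\<Sum>a\<in>{a \<in> E. x \<in> a} - {a}. charge x a) \<le> real (card ({a \<in> E. x \<in> a} - {a})) * q"
        by (rule sum_bounded_above) (rule le)
      also have "card ({a \<in> E. x \<in> a} - {a}) = 2"
        using ax finx 4 by (simp add: deg_def)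
      finally have "?L \<le> 2 * real d - 1" using q_bounds by simp
      moreover have "?M = 2 * real d - 1" using 4 by simp
      ultimately show ?thesis using s by linarith
    next
      case False
      have "?L \<le> real (card {a \<in> E. x \<in> a}) * q"
        by (rule sum_bounded_above) (rule le)
      then have L: "?L \<le> 3 * q" using 4 by (simp add: deg_def)
      obtain p where "p \<in> shared_pairs" "x \<in> p" using deg_3_shared[OF assms] 4 by auto
      then have "p \<in> {p \<in> shared_pairs - \<Union>(own_pairs ` E). x \<in> p}" using False by auto
      moreover have "finite {p \<in> shared_pairs - \<Union>(own_pairs ` E). x \<in> p}" using fin_shared by simp
      ultimately have "0 < ?n" unfolding card_gt_0_iff by blast
      then have "1 \<le> real ?n" by linarith
      then have "q * 1 \<le> q * real ?n" using q_bounds by (intro mult_left_mono) auto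
      moreover have "?M + ?s * real ?n = (2 * real d - 1) + q * real ?n" using 4 by simp
      ultimately show ?thesis using L q_bounds(2) by linarith
    qed
  next
    case 5
    have le: "charge x a \<le> q" for a using 5 q_bounds by (simp add: charge_def)
    have "?L \<le> real (card {a \<in> E. x \<in> a}) * q"
      by (rule sum_bounded_above) (rule le)
    also have "\<dots> = (deg x / 2) * (2 * q)" by (simp add: deg_def)
    also have "\<dots> \<le> (deg x / 2) * (2 * real d - 1)" using q_bounds by (intro mult_left_mono) auto
    also have "\<dots> \<le> ?M" using 5 d3 by (intro mult_right_mono) auto
    finally show ?thesis using s by simp
  qed
qed

text \<open>Pairs through a vertex of degree 1 are own pairs of weight 6, which outweigh its debt.
  Without such vertices, every vertex of degree 2 lies in an own pair and all others have degree at
  least 3. For \<open>d < 6\<close> each vertex then accounts for \<open>q\<close>; for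
  \<open>6 \<le> d\<close> the own pairs forced by vertices of degree 2 are counted.\<close>

lemma edge_charge:
  assumes a: "a \<in> E"
  shows "4 * real d - 5 \<le> (\<Sum>p\<in>own_pairs a. wt p) + (\<Sum>x\<in>a. charge x a)"
proof -
  have fa: "finite a" and ca: "card a = d" using a fin_edge card_E by auto
  have fo: "finite (own_pairs a)" using fin_own a by simp
  define J where "J = {x \<in> a. deg x = 1}"
  have J: "J \<subseteq> a" "finite J" using fa by (auto simp: J_def)
  show ?thesis
  proof (cases "J = {}")
    case False
    define j where "j = card J"
    have j1: "1 \<le> j" using False J by (simp add: j_def Suc_le_eq card_gt_0_iff)
    have "J \<noteq> a"
    proof
      assume "J = a"
      obtain x y where xy: "x \<in> a" "y \<in> a" "x \<noteq> y" "\<not> (\<exists>b\<in>B. x \<in> b \<and> y \<in> b)"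
        using irredundant[of a] a by (auto simp: E_def)
      then have "{x, y} \<in> own_pairs a"
        using deg_1_own[of a x y] a \<open>J = a\<close> by (auto simp: J_def)
      then have "{x, y} \<in> shared_pairs" using own_sub_shared a by blast
      then show False using xy(4) by (auto simp: shared_pairs_def)
    qed
    then have jd: "j < d" using J psubset_card_mono[of a J] fa ca by (auto simp: j_def)
    let ?P = "{p. p \<subseteq> a \<and> card p = 2}" and ?Q = "{p. p \<subseteq> a - J \<and> card p = 2}"
    have PQ: "finite ?P" "?Q \<subseteq> ?P" using fa by auto
    have cP: "card ?P = d choose 2" using n_subsets[OF fa] ca by simp
    have cQ: "card ?Q = (d - j) choose 2"
      using n_subsets[of "a - J" 2] fa J ca by (simp add: j_def card_Diff_subset)
    have meets: "\<exists>u\<in>p. deg u = 1" if "p \<in> ?P - ?Q" for p using that by (auto simp: J_def)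
    have sub: "?P - ?Q \<subseteq> own_pairs a"
    proof
      fix p assume p: "p \<in> ?P - ?Q"
      then obtain u where u: "u \<in> p" "deg u = 1" using meets by blast
      moreover obtain v w where "p = {v, w}" "v \<noteq> w" using p by (auto simp: card_2_iff)
      ultimately obtain y where "p = {u, y}" "u \<noteq> y" by (metis insert_commute insert_iff singletonD)
      then show "p \<in> own_pairs a" using deg_1_own[of a u y] a u p by auto
    qed
    have "real (card (?P - ?Q)) = real (card ?P) - real (card ?Q)"
      using PQ by (simp add: card_Diff_subset finite_subset card_mono of_nat_diff)
    also have "\<dots> = (real d * (real d - 1) - (real d - real j) * (real d - real j - 1)) / 2"
      unfolding cP cQ real_choose_2 using jd by (simp add: of_nat_diff diff_divide_distrib)
    finally have cnt: "2 * real (card (?P - ?Q)) = 2 * real j * real d - real j - real j * real j"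
      by (simp add: algebra_simps)
    have "wt p = 6" if "p \<in> ?P - ?Q" for p using meets[OF that] by (simp add: wt_def)
    then have "(\<Sum>p\<in>?P - ?Q. wt p) = (\<Sum>p\<in>?P - ?Q. 6)" by (rule sum.cong[OF refl])
    then have "6 * real (card (?P - ?Q)) = (\<Sum>p\<in>?P - ?Q. wt p)" by simp
    also have "\<dots> \<le> (\<Sum>p\<in>own_pairs a. wt p)"
      by (rule sum_mono2[OF fo sub]) (simp add: less_imp_le wt_bounds)
    finally have own: "6 * real (card (?P - ?Q)) \<le> (\<Sum>p\<in>own_pairs a. wt p)" .
    have "(\<Sum>x\<in>a. charge x a) = (\<Sum>x\<in>J. charge x a) + (\<Sum>x\<in>a - J. charge x a)"
      using J fa by (simp add: sum.subset_diff)
    moreover have "(\<Sum>x\<in>J. charge x a) = - real j * (2 * real d - 1)"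
      by (simp add: J_def charge_def j_def algebra_simps)
    moreover have "0 \<le> (\<Sum>x\<in>a - J. charge x a)"
      by (rule sum_nonneg) (auto intro: charge_nonneg simp: J_def)
    \<comment> \<open>The own pairs meeting \<open>J\<close>, less the debts
      \<open>j * (2 * d - 1)\<close>, exceed the demand by exactly this product. It vanishes for
      \<open>j = 1\<close>, as in the extremal configuration.\<close>
    moreover have "0 \<le> (real j - 1) * (4 * real d - 5 - 3 * real j)"
      using j1 jd by (intro mult_nonneg_nonneg) auto
    ultimately show ?thesis using own cnt by (simp add: algebra_simps)
  next
    case True
    then have pos: "2 \<le> deg x" if "x \<in> a" for x
      using that deg_pos[OF a that] by (auto simp: J_def)
    have owned: "x \<in> \<Union>(own_pairs a)" if x: "x \<in> a" "deg x = 2" for x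
    proof -
      obtain g where g: "g \<in> E" "x \<in> g" "g \<noteq> a" "{e \<in> E. x \<in> e} = {a, g}"
        using deg_2_other[OF x(2) a x(1)] by blast
      obtain y where "y \<in> a" "y \<notin> g" using edge_diff[of a g] a g by blast
      then have "{x, y} \<in> own_pairs a" by (rule deg_2_own[OF g(4)])
      then show ?thesis by blast
    qed
    show ?thesis
    proof (cases "6 \<le> d")
      case False
      \<comment> \<open>An own pair has weight at least \<open>2 * q\<close>, hence \<open>q\<close>
        for each of its vertices in \<open>M\<close>. Vertices outside \<open>M\<close> have degree
        at least 3 by \<open>owned\<close> and pay \<open>q\<close> themselves.\<close>
      define M where "M = \<Union>(own_pairs a)"
      have M: "M \<subseteq> a" "finite M" using fa by (auto simp: M_def own_pairs_def finite_subset)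
      have "card M \<le> (\<Sum>p\<in>own_pairs a. card p)" unfolding M_def by (rule card_Union_le_sum_card)
      also have "\<dots> = 2 * card (own_pairs a)" by (simp add: own_pairs_def)
      finally have cM: "real (card M) \<le> 2 * real (card (own_pairs a))" by linarith
      have "real (card (own_pairs a)) * (2 * q) \<le> (\<Sum>p\<in>own_pairs a. wt p)"
        using wt_bounds(3) False by (intro sum_bounded_below) auto
      moreover have "real (card M) * q \<le> 2 * real (card (own_pairs a)) * q"
        using cM q_bounds by (intro mult_right_mono) auto
      moreover have "(\<Sum>x\<in>a. charge x a) = (\<Sum>x\<in>M. charge x a) + (\<Sum>x\<in>a - M. charge x a)"
        using M fa by (simp add: sum.subset_diff)
      moreover have "0 \<le> (\<Sum>x\<in>M. charge x a)"
        by (rule sum_nonneg) (use M pos in \<open>force intro: charge_nonneg\<close>)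
      moreover have "(\<Sum>x\<in>a - M. charge x a) = (\<Sum>x\<in>a - M. q)"
      proof (rule sum.cong[OF refl])
        fix x assume "x \<in> a - M"
        then have "2 \<le> deg x" "deg x \<noteq> 2" "x \<notin> \<Union>(own_pairs a)"
          using pos owned by (auto simp: M_def)
        then show "charge x a = q" using False by (simp add: charge_def)
      qed
      moreover have "(\<Sum>x\<in>a - M. q) = (real d - real (card M)) * q"
        using M ca card_mono[OF fa M(1)] by (simp add: card_Diff_subset of_nat_diff)
      ultimately show ?thesis using q_bounds(3) by (simp add: algebra_simps)
    next
      case d6: True
      define T where "T = {x \<in> a. deg x = 2}"
      have T: "T \<subseteq> a" "finite T" using fa by (auto simp: T_def)
      have td: "card T \<le> d" using T fa ca card_mono by blast
      define r where "r = (2 * real d - 1) / 3"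
      have "(\<Sum>x\<in>a. charge x a) = (\<Sum>x\<in>T. charge x a) + (\<Sum>x\<in>a - T. charge x a)"
        using T fa by (simp add: sum.subset_diff)
      also have "(\<Sum>x\<in>T. charge x a) = 0" by (simp add: T_def charge_def)
      also have "(\<Sum>x\<in>a - T. charge x a) = (\<Sum>x\<in>a - T. r)"
      proof (rule sum.cong[OF refl])
        fix x assume "x \<in> a - T"
        then have "2 \<le> deg x" "deg x \<noteq> 2" using pos by (auto simp: T_def)
        then show "charge x a = r" using d6 by (simp add: charge_def r_def)
      qed
      also have "\<dots> = (real d - real (card T)) * r"
        using T fa ca by (simp add: card_Diff_subset card_mono of_nat_diff td)
      finally have ch: "(\<Sum>x\<in>a. charge x a) = (real d - real (card T)) * r" by simp
      have own: "(\<Sum>p\<in>own_pairs a. wt p) = 6 * real (card (own_pairs a))"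
        using d6 by (simp add: wt_def)
      \<comment> \<open>In terms of \<open>r\<close> the demand \<open>4 * d - 5\<close> is
        \<open>6 * r - 3\<close>.\<close>
      have r: "2 * real d = 3 * r + 1" "3 < r" using d6 by (simp_all add: r_def field_simps)
      \<comment> \<open>Let \<open>g\<close> be the second edge at \<open>x\<close> and let
        \<open>y\<close> in \<open>a\<close> avoid \<open>g\<close>. Another vertex \<open>z\<close>
        of degree 2 either lies in \<open>g\<close>, and then \<open>{z, y}\<close> is own because
        \<open>g\<close> is its only other edge, or avoids \<open>g\<close>, and then
        \<open>{x, z}\<close> is own. With \<open>{x, y}\<close> these pairs form a double star, so
        they are distinct.\<close>
      have N: "1 \<le> card (own_pairs a) \<and> card T \<le> card (own_pairs a) + 1" if ne: "T \<noteq> {}"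
      proof -
        obtain x where x: "x \<in> a" "deg x = 2" using ne unfolding T_def by blast
        obtain g where g: "g \<in> E" "x \<in> g" "g \<noteq> a" "{e \<in> E. x \<in> e} = {a, g}"
          using deg_2_other[OF x(2) a x(1)] by blast
        obtain y where y: "y \<in> a" "y \<notin> g" using edge_diff[of a g] a g by blast
        define pr where "pr z = (if z \<in> g then {z, y} else {x, z})" for z
        define S where "S = T - {x, y}"
        have xy: "{x, y} \<in> own_pairs a" using y by (rule deg_2_own[OF g(4)])
        have "pr z \<in> own_pairs a" if z: "z \<in> S" for z
        proof (cases "z \<in> g")
          case True
          have za: "z \<in> a" "deg z = 2" using z by (auto simp: S_def T_def)
          then obtain g' where "{e \<in> E. z \<in> e} = {a, g'}" "g' \<noteq> a"
            using deg_2_other[OF za(2) a za(1)] by blast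
          moreover have "g \<in> {e \<in> E. z \<in> e}" using True g by simp
          ultimately have "{e \<in> E. z \<in> e} = {a, g}" using g(3) by (metis insert_iff singletonD)
          then have "{z, y} \<in> own_pairs a" using y by (rule deg_2_own)
          then show ?thesis using True by (simp add: pr_def)
        next
          case False
          moreover have "z \<in> a" using z by (simp add: S_def T_def)
          ultimately have "{x, z} \<in> own_pairs a" by (intro deg_2_own[OF g(4)])
          then show ?thesis using False by (simp add: pr_def)
        qed
        then have sub: "insert {x, y} (pr ` S) \<subseteq> own_pairs a" using xy by auto
        have "x \<noteq> y" using g(2) y by blast
        have inj: "inj_on pr S" using g(2) y
          by (auto simp: inj_on_def pr_def S_def doubleton_eq_iff split: if_splits)
        have "{x, y} \<notin> pr ` S" using g(2) y
          by (auto simp: pr_def S_def doubleton_eq_iff split: if_splits)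
        then have "card (insert {x, y} (pr ` S)) = Suc (card S)"
          using inj T by (simp add: card_image S_def)
        moreover have "card T - card {x, y} \<le> card S"
          unfolding S_def by (rule diff_card_le_card_Diff) simp
        moreover have "card {x, y} = 2" using \<open>x \<noteq> y\<close> by simp
        ultimately show ?thesis using card_mono[OF fo sub] by linarith
      qed
      show ?thesis
      proof (cases "T = {}")
        case True
        have "6 * r \<le> real d * r" using d6 r by (intro mult_right_mono) auto
        moreover have "(\<Sum>x\<in>a. charge x a) = real d * r" using ch True by simp
        ultimately show ?thesis using own r by linarith
      next
        case False
        define u where "u = real d - real (card T)"
        have u0: "0 \<le> u" using td by (simp add: u_def)
        have n: "real d - u - 1 \<le> real (card (own_pairs a))" "1 \<le> real (card (own_pairs a))"
          using N[OF False] by (auto simp: u_def)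
        \<comment> \<open>For \<open>r < 6\<close> the worst case is
          \<open>2 * u = 3 * r - 3\<close>, where the lower bounds \<open>d - u - 1\<close> and 1 on
          the number of own pairs agree. The surplus there is
          \<open>3 * (r - 2) * (r - 3) / 2\<close>.\<close>
        have "6 * r - 3 \<le> 6 * real (card (own_pairs a)) + u * r"
        proof (cases "r \<ge> 6")
          case True
          then have "0 \<le> u * (r - 6)" using u0 by (intro mult_nonneg_nonneg) auto
          then have "6 * u \<le> u * r" by (simp add: algebra_simps)
          then show ?thesis using n r by linarith
        next
          case r6: False
          show ?thesis
          proof (cases "2 * u \<le> 3 * r - 3")
            case True
            have "0 \<le> (3 * r - 3 - 2 * u) * (6 - r)" "0 \<le> (r - 2) * (r - 3)"
              using True r6 r by (auto intro!: mult_nonneg_nonneg)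
            then show ?thesis using n r by (simp add: algebra_simps)
          next
            case False
            then have "(3 * r - 3) * r \<le> 2 * u * r" using r by (intro mult_right_mono) auto
            moreover have "0 \<le> (r - 2) * (r - 3)" using r by auto
            ultimately show ?thesis using n r by (simp add: algebra_simps)
          qed
        qed
        then show ?thesis using ch own r by (simp add: u_def)
      qed
    qed
  qed
qed

text \<open>With \<open>k = card (b \<inter> W)\<close>, weight 6 on all pairs of
  \<open>b \<inter> W\<close> leaves the surplus \<open>(k - 2) * (4 * d - 5 - 3 * k)\<close>,
  nonnegative if \<open>6 \<le> d\<close> or \<open>k < d\<close>. In the remaining case
  \<open>b\<close> lies inside \<open>W\<close>: either a vertex of degree 1 leaves some pair of
  \<open>b\<close> unshared, or all shared pairs in \<open>b\<close> have the smaller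
  weight.\<close>

lemma shared_in_edge_weight:
  assumes b: "b \<in> B" and k2: "2 \<le> card (b \<inter> W)"
  shows "(\<Sum>p\<in>{p \<in> shared_pairs. p \<subseteq> b}. wt p) \<le>
    (4 * real d - 2) * (real (card (b \<inter> W)) - 2) + 6"
proof -
  define S where "S = {p \<in> shared_pairs. p \<subseteq> b}"
  define k where "k = card (b \<inter> W)"
  define P where "P = {p. p \<subseteq> b \<inter> W \<and> card p = 2}"
  have fb: "finite b" and cb: "card b = d" using fin_edge card_edge b by auto
  have kd: "k \<le> d" unfolding k_def using cb card_mono[OF fb, of "b \<inter> W"] by simp
  have fP: "finite P" using fb by (simp add: P_def)
  have cP: "real (card P) = real k * (real k - 1) / 2"
    unfolding P_def using n_subsets[of "b \<inter> W" 2] fb by (simp add: k_def real_choose_2)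
  have SP: "S \<subseteq> P" by (auto simp: S_def P_def shared_pairs_def W_def)
  have le6: "(\<Sum>p\<in>S. wt p) \<le> real (card S) * 6" by (rule sum_bounded_above) (rule wt_bounds)
  have cSP: "card S \<le> card P" using card_mono[OF fP SP] .
  have "(\<Sum>p\<in>S. wt p) \<le> (4 * real d - 2) * (real k - 2) + 6"
  proof (cases "6 \<le> d \<or> k < d")
    case True
    then have "0 \<le> (real k - 2) * (4 * real d - 5 - 3 * real k)"
      using k2 kd d3 by (intro mult_nonneg_nonneg) (auto simp: k_def)
    moreover have "real (card S) \<le> real k * (real k - 1) / 2" using cSP cP by linarith
    ultimately show ?thesis using le6 by (simp add: algebra_simps)
  next
    case False
    then have d: "d \<le> 5" "k = d" using kd by auto
    then have bW: "b \<inter> W = b" using card_subset_eq[OF fb, of "b \<inter> W"] cb by (simp add: k_def)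
    show ?thesis
    proof (cases "\<exists>u\<in>b. deg u = 1")
      case True
      then obtain u where u: "u \<in> b" "deg u = 1" by blast
      obtain g where g: "g \<in> E" "u \<in> g" using u bW by (auto simp: W_def)
      have "b \<noteq> g" using disj b g by (auto simp: E_def)
      then obtain y where y: "y \<in> b" "y \<notin> g" using edge_diff[of b g] b g by blast
      have "{u, y} \<notin> S"
      proof
        assume "{u, y} \<in> S"
        then obtain g' where "g' \<in> E" "{u, y} \<subseteq> g'" by (auto simp: S_def shared_pairs_def)
        then show False using deg_1_unique[OF u(2) g, of g'] y by blast
      qed
      moreover have "u \<noteq> y" using g y by blast
      then have "{u, y} \<in> P" using u y bW by (simp add: P_def)
      ultimately have "card S < card P" using SP fP by (intro psubset_card_mono) auto
      then have "real (card S) + 1 \<le> real (card P)" by linarith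
      then have "real (card S) + 1 \<le> real d * (real d - 1) / 2" using cP d by simp
      moreover have "0 \<le> (real d - 3) * (real d - 4)"
        using d3 by (cases "d = 3") (auto intro!: mult_nonneg_nonneg)
      ultimately show ?thesis using le6 d by (simp add: algebra_simps)
    next
      case False
      then have "wt p \<le> 2 * q" if "p \<in> S" for p using that d by (auto simp: wt_def S_def)
      then have "(\<Sum>p\<in>S. wt p) \<le> real (card S) * (2 * q)" by (rule sum_bounded_above)
      also have "\<dots> \<le> real (card P) * (2 * q)" using cSP q_bounds by (intro mult_right_mono) auto
      also have "\<dots> = (q * real d) * (real d - 1)" using cP d by simp
      also have "\<dots> = (4 * real d - 5) * (real d - 1)" by (simp only: q_bounds)
      \<comment> \<open>The supply exceeds this by \<open>5 - d\<close>.\<close>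
      finally show ?thesis using d by (simp add: algebra_simps)
    qed
  qed
  then show ?thesis by (simp add: S_def k_def)
qed

section \<open>Summing the local balances\<close>

lemma edge_demand:
  "real (card E) * (4 * real d - 5) \<le>
     (\<Sum>p\<in>shared_pairs. wt p) + (\<Sum>x\<in>W. (real (deg x) - 2) * (2 * real d - 1))"
proof -
  define Z where "Z = shared_pairs - \<Union>(own_pairs ` E)"
  define s where "s = (if 6 \<le> d then 0 else q)"
  have fZ: "finite Z" using fin_shared by (simp add: Z_def)
  have sub: "\<Union>(own_pairs ` E) \<subseteq> shared_pairs" using own_sub_shared by blast
  have "real (card E) * (4 * real d - 5) \<le>
      (\<Sum>a\<in>E. (\<Sum>p\<in>own_pairs a. wt p) + (\<Sum>x\<in>a. charge x a))"
    by (rule sum_bounded_below) (rule edge_charge)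
  also have "\<dots> = (\<Sum>a\<in>E. \<Sum>p\<in>own_pairs a. wt p) + (\<Sum>a\<in>E. \<Sum>x\<in>a. charge x a)"
    by (rule sum.distrib)
  also have "(\<Sum>a\<in>E. \<Sum>p\<in>own_pairs a. wt p) = (\<Sum>p\<in>\<Union>(own_pairs ` E). wt p)"
    using finE fin_own own_disjoint by (intro sum.UNION_disjoint[symmetric]) auto
  also have "(\<Sum>a\<in>E. \<Sum>x\<in>a. charge x a) = (\<Sum>a\<in>E. \<Sum>x | x \<in> W \<and> x \<in> a. charge x a)"
    by (intro sum.cong refl) (auto simp: W_def)
  also have "\<dots> = (\<Sum>x\<in>W. \<Sum>a\<in>{a \<in> E. x \<in> a}. charge x a)"
    by (rule sum.swap_restrict[OF finE finW])
  also have "\<dots> \<le> (\<Sum>x\<in>W. (real (deg x) - 2) * (2 * real d - 1) + s * card {p \<in> Z. x \<in> p})"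
    unfolding s_def Z_def by (intro sum_mono vertex_charge)
  also have "\<dots> = (\<Sum>x\<in>W. (real (deg x) - 2) * (2 * real d - 1)) + s * (\<Sum>x\<in>W. real (card {p \<in> Z. x \<in> p}))"
    by (simp add: sum.distrib sum_distrib_left)
  also have "(\<Sum>x\<in>W. real (card {p \<in> Z. x \<in> p})) = (\<Sum>x\<in>W. \<Sum>p | p \<in> Z \<and> x \<in> p. 1)" by simp
  also have "\<dots> = (\<Sum>p\<in>Z. \<Sum>x | x \<in> W \<and> x \<in> p. 1)"
    by (rule sum.swap_restrict[OF finW fZ])
  also have "\<dots> = (\<Sum>p\<in>Z. 2)"
  proof (rule sum.cong[OF refl])
    fix p assume "p \<in> Z"
    then have "card p = 2" "{x. x \<in> W \<and> x \<in> p} = p" by (auto simp: Z_def shared_pairs_def W_def)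
    then show "(\<Sum>x | x \<in> W \<and> x \<in> p. 1) = (2::real)" by simp
  qed
  \<comment> \<open>A pair in \<open>Z\<close> pays no edge directly, so its weight is free to give
    \<open>s\<close> to both endpoints.\<close>
  also have "s * (\<Sum>p\<in>Z. 2) \<le> (\<Sum>p\<in>Z. wt p)"
  proof -
    have "real (card Z) * (2 * s) \<le> (\<Sum>p\<in>Z. wt p)"
      using wt_bounds by (intro sum_bounded_below) (auto simp: s_def less_imp_le)
    then show ?thesis by (simp add: mult_ac)
  qed
  finally have "real (card E) * (4 * real d - 5) \<le> (\<Sum>p\<in>\<Union>(own_pairs ` E). wt p) +
      ((\<Sum>x\<in>W. (real (deg x) - 2) * (2 * real d - 1)) + (\<Sum>p\<in>Z. wt p))" by simp
  moreover have "(\<Sum>p\<in>shared_pairs. wt p) = (\<Sum>p\<in>Z. wt p) + (\<Sum>p\<in>\<Union>(own_pairs ` E). wt p)"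
    unfolding Z_def by (rule sum.subset_diff[OF sub fin_shared])
  ultimately show ?thesis by simp
qed

text \<open>A hyperedge \<open>b\<close> adds at most \<open>d - card (b \<inter> W)\<close>
  vertices to \<open>W\<close>. The term in \<open>card (b \<inter> W)\<close> of its supply cancels
  against this, so every \<open>b\<close> ends up with the same coefficient as an edge of
  \<open>A\<close>.\<close>

lemma dense_part:
  assumes le: "card C \<le> card A"
  defines "B' \<equiv> {b \<in> B. 2 \<le> card (b \<inter> W)}"
  shows "(2 * real d - 1) * real (card (W \<union> \<Union>B')) \<le>
    (2 * real d * real d - 5 * real d + 5) * real (card (A \<union> B'))"
proof -
  let ?k = "\<lambda>b. real (card (b \<inter> W))"
  have fB: "finite B'" using fin by (simp add: B'_def)
  have "(\<Sum>p\<in>shared_pairs. wt p) \<le> (\<Sum>p\<in>shared_pairs. \<Sum>b | b \<in> B' \<and> p \<subseteq> b. wt p)"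
  proof (rule sum_mono)
    fix p assume p: "p \<in> shared_pairs"
    then obtain b where b: "b \<in> B" "p \<subseteq> b" by (auto simp: shared_pairs_def)
    have "p \<subseteq> b \<inter> W" "card p = 2" using b p by (auto simp: shared_pairs_def W_def)
    then have "b \<in> {b. b \<in> B' \<and> p \<subseteq> b}"
      using b card_mono[of "b \<inter> W" p] fin_edge[of b] by (auto simp: B'_def)
    then have "card {b. b \<in> B' \<and> p \<subseteq> b} \<noteq> 0" using fB by (subst card_eq_0_iff) auto
    then have "1 * wt p \<le> real (card {b. b \<in> B' \<and> p \<subseteq> b}) * wt p"
      using wt_bounds(1)[of p] by (intro mult_right_mono) auto
    then show "wt p \<le> (\<Sum>b | b \<in> B' \<and> p \<subseteq> b. wt p)" by simp
  qed
  also have "\<dots> = (\<Sum>b\<in>B'. \<Sum>p | p \<in> shared_pairs \<and> p \<subseteq> b. wt p)"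
    by (rule sum.swap_restrict[OF fin_shared fB])
  also have "\<dots> \<le> (\<Sum>b\<in>B'. (4 * real d - 2) * (?k b - 2) + 6)"
    by (intro sum_mono shared_in_edge_weight) (auto simp: B'_def)
  also have "\<dots> = (4 * real d - 2) * (\<Sum>b\<in>B'. ?k b) - (8 * real d - 10) * real (card B')"
    by (simp add: sum.distrib sum_subtractf sum_distrib_left[symmetric] algebra_simps)
  finally have 1: "(\<Sum>p\<in>shared_pairs. wt p) \<le>
     (4 * real d - 2) * (\<Sum>b\<in>B'. ?k b) - (8 * real d - 10) * real (card B')" .
  have "(\<Sum>x\<in>W. real (deg x)) = (\<Sum>x\<in>W. \<Sum>g | g \<in> E \<and> x \<in> g. 1)" by (simp add: deg_def)
  also have "\<dots> = (\<Sum>g\<in>E. \<Sum>x | x \<in> W \<and> x \<in> g. 1)"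
    by (rule sum.swap_restrict[OF finW finE])
  also have "\<dots> = (\<Sum>g\<in>E. real d)"
  proof (rule sum.cong[OF refl])
    fix g assume "g \<in> E"
    then have "{x. x \<in> W \<and> x \<in> g} = g" "card g = d" using card_E by (auto simp: W_def)
    then show "(\<Sum>x | x \<in> W \<and> x \<in> g. 1) = real d" by simp
  qed
  finally have dg: "(\<Sum>x\<in>W. real (deg x)) = real (card E) * real d" by simp
  have 2: "(\<Sum>x\<in>W. (real (deg x) - 2) * (2 * real d - 1)) =
      (2 * real d - 1) * (real (card E) * real d - 2 * real (card W))"
    unfolding dg[symmetric]
    by (subst sum_distrib_right[symmetric]) (simp add: sum_subtractf)
  have cE: "real (card E) = real (card A) + real (card C)"
    using fin disj by (simp add: E_def card_Un_disjoint)
  have pos: "0 \<le> 2 * real d * real d - 5 * real d + 5"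
  proof -
    have "0 \<le> real d * (2 * real d - 5)" using d3 by (intro mult_nonneg_nonneg) auto
    then show ?thesis by (simp add: algebra_simps)
  qed
  then have "(2 * real d * real d - 5 * real d + 5) * real (card E) \<le>
      (2 * real d * real d - 5 * real d + 5) * (2 * real (card A))"
    using le cE by (intro mult_left_mono) auto
  \<comment> \<open>The coefficient of \<open>card E\<close> is
    \<open>d * (2 * d - 1) - (4 * d - 5)\<close>, by counting incidences in \<open>E\<close> and
    subtracting the demand.\<close>
  then have 3: "2 * (2 * real d - 1) * real (card W) \<le>
      2 * (2 * real d * real d - 5 * real d + 5) * real (card A)
      + (4 * real d - 2) * (\<Sum>b\<in>B'. ?k b) - (8 * real d - 10) * real (card B')"
    using edge_demand 1 2 by (simp add: algebra_simps)
  have "card (W \<union> \<Union>B') \<le> card W + card (\<Union>b\<in>B'. b - W)"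
  proof -
    have "W \<union> \<Union>B' = W \<union> (\<Union>b\<in>B'. b - W)" by auto
    then show ?thesis by (metis card_Un_le)
  qed
  also have "card (\<Union>b\<in>B'. b - W) \<le> (\<Sum>b\<in>B'. card (b - W))" by (rule card_UN_le[OF fB])
  finally have "real (card (W \<union> \<Union>B')) \<le> real (card W) + (\<Sum>b\<in>B'. real (card (b - W)))"
    by (simp flip: of_nat_sum of_nat_add)
  also have "(\<Sum>b\<in>B'. real (card (b - W))) = (\<Sum>b\<in>B'. real d - ?k b)"
  proof (rule sum.cong[OF refl])
    fix b assume "b \<in> B'"
    then have "finite b" "card b = d" using fin_edge card_edge by (auto simp: B'_def)
    then have "card (b - W) + card (b \<inter> W) = d"
      by (metis Int_Diff_Un Int_Diff_disjoint card_Un_disjoint finite_Diff finite_Int add.commute)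
    then show "real (card (b - W)) = real d - ?k b" by linarith
  qed
  also have "\<dots> = real (card B') * real d - (\<Sum>b\<in>B'. ?k b)" by (simp add: sum_subtractf)
  finally have "(2 * real d - 1) * real (card (W \<union> \<Union>B')) \<le>
      (2 * real d - 1) * (real (card W) + (real (card B') * real d - (\<Sum>b\<in>B'. ?k b)))"
    using d3 by (intro mult_left_mono) auto
  moreover have "real (card (A \<union> B')) = real (card A) + real (card B')"
    using fin fB disj by (subst card_Un_disjoint) (auto simp: B'_def)
  ultimately show ?thesis using 3 by (simp add: algebra_simps)
qed

end

section \<open>From preimages to the pair of covers\<close>

lemma Proj_edge_iff:
  "x \<noteq> y \<Longrightarrow> {x, y} \<in> hedges (Proj H) \<longleftrightarrow> (\<exists>e\<in>hedges H. x \<in> e \<and> y \<in> e)"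
  by (auto simp: Proj_def doubleton_eq_iff)

lemma preimage_edge_iff:
  "preimage d G H \<Longrightarrow> x \<noteq> y \<Longrightarrow> {x, y} \<in> hedges G \<longleftrightarrow> (\<exists>e\<in>hedges H. x \<in> e \<and> y \<in> e)"
  using Proj_edge_iff[of x y H] by (auto simp: preimage_def)

lemma preimage_verts: "preimage d G H \<Longrightarrow> hverts H = hverts G"
  by (auto simp: preimage_def Proj_def)

lemma preimage_finite: "preimage d G H \<Longrightarrow> finite (hverts H) \<and> finite (hedges H)"
  by (auto simp: preimage_def uniform_hypergraph_def intro: finite_subset[of _ "Pow (hverts H)"])

lemma preimage_edge: "preimage d G H \<Longrightarrow> e \<in> hedges H \<Longrightarrow> e \<subseteq> hverts G \<and> card e = d"
  using preimage_verts[of d G H] unfolding preimage_def uniform_hypergraph_def by simp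

text \<open>Otherwise deleting \<open>a\<close> would leave a preimage. Since \<open>least\<close>
  ranges only over subfamilies of \<open>H\<close>, it holds both for a preimage that is smallest
  inside \<open>h\<close> and for a minimal one.\<close>

lemma private_pair:
  assumes H: "preimage d G H" and a: "a \<in> hedges H"
    and least: "\<And>X. X \<subset> hedges H \<Longrightarrow> \<not> preimage d G \<lparr>hverts = hverts H, hedges = X\<rparr>"
  shows "\<exists>x\<in>a. \<exists>y\<in>a. x \<noteq> y \<and> \<not> (\<exists>b\<in>hedges H - {a}. x \<in> b \<and> y \<in> b)"
proof (rule ccontr)
  assume "\<not> ?thesis"
  then have cov: "\<And>x y. x \<in> a \<Longrightarrow> y \<in> a \<Longrightarrow> x \<noteq> y \<Longrightarrow> \<exists>b\<in>hedges H - {a}. x \<in> b \<and> y \<in> b"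
    by blast
  define K where "K = \<lparr>hverts = hverts H, hedges = hedges H - {a}\<rparr>"
  have "(\<exists>e\<in>hedges H. {i, j} \<subseteq> e) \<longleftrightarrow> (\<exists>e\<in>hedges K. {i, j} \<subseteq> e)" if "i \<noteq> j" for i j
    using cov[of i j] that by (auto simp: K_def)
  then have "(\<lambda>p. \<exists>i j. p = {i, j} \<and> i \<noteq> j \<and> (\<exists>e\<in>hedges K. {i, j} \<subseteq> e)) =
      (\<lambda>p. \<exists>i j. p = {i, j} \<and> i \<noteq> j \<and> (\<exists>e\<in>hedges H. {i, j} \<subseteq> e))"
    by (intro ext ex_cong1 conj_cong refl) simp
  then have "Proj K = Proj H" unfolding Proj_def by (simp add: K_def)
  then have "preimage d G K" using H by (auto simp: preimage_def uniform_hypergraph_def K_def)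
  then show False using least[of "hedges H - {a}"] a by (auto simp: K_def)
qed

theorem theorem16:
  fixes d :: nat and G h :: "'a hypergraph"
  assumes "d \<ge> 3"
    and "simple_graph G"
    and "ambiguous d G"
    and "preimage d G h"
  shows "real d - 1 - 1 / max_density h \<ge> (2 * real d - 4) / (2 * real d - 1)"
proof -
  define pre where "pre X \<longleftrightarrow> X \<subseteq> hedges h \<and> preimage d G \<lparr>hverts = hverts h, hedges = X\<rparr>" for X
  have h: "preimage d G h" by (rule assms)
  have "pre (hedges h)" using h by (cases h) (simp add: pre_def)
  \<comment> \<open>A minimal preimage of \<open>G\<close> need not lie in \<open>h\<close>.
    Choosing a smallest one inside \<open>h\<close> keeps \<open>A\<close> and \<open>B\<close>
    among the hyperedges of \<open>h\<close>.\<close>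
  then obtain X where X: "pre X" and Xleast: "\<And>Y. pre Y \<Longrightarrow> card X \<le> card Y"
    using ex_has_least_nat[of pre _ card] by blast
  define P where "P = \<lparr>hverts = hverts h, hedges = X\<rparr>"
  have P: "preimage d G P" "hedges P \<subseteq> hedges h" using X by (simp_all add: P_def pre_def)
  obtain Q where minQ: "minimal_preimage d G Q" and "P \<noteq> Q"
  proof -
    obtain H1 H2 where "minimal_preimage d G H1" "minimal_preimage d G H2" "H1 \<noteq> H2"
      using assms(3) unfolding ambiguous_def by blast
    then show ?thesis using that by (cases "P = H1") blast+
  qed
  have Q: "preimage d G Q" using minQ by (simp add: minimal_preimage_def)
  have Qle: "card (hedges Q) \<le> card (hedges Y)" if "preimage d G Y" for Y
    using minQ that by (simp add: minimal_preimage_def)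
  have fP: "finite (hedges P)" and fQ: "finite (hedges Q)" using preimage_finite P Q by auto
  have vPQ: "hverts P = hverts G" "hverts Q = hverts G" using preimage_verts P Q by auto
  have neq: "hedges P \<noteq> hedges Q"
    using \<open>P \<noteq> Q\<close> vPQ by (auto intro: hypergraph.equality)
  have privP: "\<exists>x\<in>a. \<exists>y\<in>a. x \<noteq> y \<and> \<not> (\<exists>b\<in>hedges P - {a}. x \<in> b \<and> y \<in> b)" if "a \<in> hedges P" for a
  proof (rule private_pair[OF P(1) that])
    fix Y assume Y: "Y \<subset> hedges P"
    then have "card Y < card X" using fP psubset_card_mono[of X Y] by (simp add: P_def)
    then show "\<not> preimage d G \<lparr>hverts = hverts P, hedges = Y\<rparr>"
      using Xleast[of Y] Y X by (auto simp: P_def pre_def)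
  qed
  have privQ: "\<exists>x\<in>a. \<exists>y\<in>a. x \<noteq> y \<and> \<not> (\<exists>b\<in>hedges Q - {a}. x \<in> b \<and> y \<in> b)" if "a \<in> hedges Q" for a
  proof (rule private_pair[OF Q that])
    fix Y assume Y: "Y \<subset> hedges Q"
    then have "card Y < card (hedges Q)" using fQ psubset_card_mono by blast
    then show "\<not> preimage d G \<lparr>hverts = hverts Q, hedges = Y\<rparr>"
      using Qle[of "\<lparr>hverts = hverts Q, hedges = Y\<rparr>"] by auto
  qed
  define A B C where "A = hedges P - hedges Q" and "B = hedges P \<inter> hedges Q"
    and "C = hedges Q - hedges P"
  have AB: "hedges P = B \<union> A" and BC: "hedges Q = B \<union> C" by (auto simp: A_def B_def C_def)
  have edge: "g \<subseteq> hverts G \<and> card g = d" if "g \<in> A \<union> B \<union> C" for g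
    using that preimage_edge[OF P(1), of g] preimage_edge[OF Q, of g] by (auto simp: A_def B_def C_def)
  have same: "(\<exists>g\<in>B \<union> A. x \<in> g \<and> y \<in> g) \<longleftrightarrow> (\<exists>g\<in>B \<union> C. x \<in> g \<and> y \<in> g)" if "x \<noteq> y" for x y
    using preimage_edge_iff[OF P(1) that] preimage_edge_iff[OF Q that]
    unfolding AB BC by simp
  interpret cover_pair d A B C
  proof
    show "finite A" "finite B" "finite C" using fP fQ by (auto simp: A_def B_def C_def)
    show "A \<inter> C = {}" "B \<inter> (A \<union> C) = {}" by (auto simp: A_def B_def C_def)
    show "\<exists>x\<in>a. \<exists>y\<in>a. x \<noteq> y \<and> \<not> (\<exists>b\<in>B. x \<in> b \<and> y \<in> b)" if "a \<in> A \<union> C" for a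
    proof (cases "a \<in> A")
      case True
      then have "B \<subseteq> hedges P - {a}" "a \<in> hedges P" by (auto simp: A_def B_def)
      then show ?thesis using privP[of a] by blast
    next
      case False
      then have "B \<subseteq> hedges Q - {a}" "a \<in> hedges Q" using that by (auto simp: C_def B_def)
      then show ?thesis using privQ[of a] by blast
    qed
    show "3 \<le> d" by (rule assms)
    show "card g = d" if "g \<in> A \<union> B \<union> C" for g using edge[OF that] ..
    show "\<exists>g\<in>B \<union> C. x \<in> g \<and> y \<in> g" if "a \<in> A" "x \<in> a" "y \<in> a" "x \<noteq> y" for a x y
      using same[OF that(4)] that(1-3) by blast
    show "\<exists>g\<in>B \<union> A. x \<in> g \<and> y \<in> g" if "a \<in> C" "x \<in> a" "y \<in> a" "x \<noteq> y" for a x y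
      using same[OF that(4)] that(1-3) by blast
  qed
  have le: "card C \<le> card A"
  proof -
    have "card (hedges P) = card B + card A" "card (hedges Q) = card B + card C"
      unfolding AB BC using fin disj by (auto intro!: card_Un_disjoint)
    then show ?thesis using Qle[OF P(1)] by simp
  qed
  define B' where "B' = {b \<in> B. 2 \<le> card (b \<inter> W)}"
  define K where "K = \<lparr>hverts = W \<union> \<Union>B', hedges = A \<union> B'\<rparr>"
  have "A \<union> C \<noteq> {}" using neq by (auto simp: A_def C_def)
  then have Wne: "W \<noteq> {}" using card_E assms(1) by (fastforce simp: W_def E_def)
  \<comment> \<open>Edges of \<open>C\<close> may be absent from \<open>h\<close>, but their
    vertices are not: all preimages have the vertex set of \<open>G\<close>.\<close>
  have "hverts K \<subseteq> hverts h"
    using edge preimage_verts[OF h] by (fastforce simp: K_def W_def E_def B'_def)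
  moreover have "hedges K \<subseteq> hedges h"
    using P(2) by (auto simp: K_def A_def B_def B'_def)
  ultimately have K: "subhypergraph K h" "hverts K \<noteq> {}"
    using Wne by (auto simp: subhypergraph_def K_def W_def E_def)
  have unif: "uniform_hypergraph d h" using h by (simp add: preimage_def)
  have "hverts h \<noteq> {}" using K by (auto simp: subhypergraph_def)
  then have "edge_density K \<le> max_density h"
    unfolding max_density_def using max_density_set(1)[OF unif] K by (intro Max_ge) auto
  \<comment> \<open>Only the numerator of the vertex-to-hyperedge ratio; the ratio itself is
    \<open>c / (2 * d - 1)\<close>.\<close>
  define c where "c = (2 * real d * real d - 5 * real d + 5)"
  have c0: "0 < c"
  proof -
    have "0 \<le> real d * (2 * real d - 5)" using assms(1) by (intro mult_nonneg_nonneg) auto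
    then show ?thesis by (simp add: c_def algebra_simps)
  qed
  have "finite (hverts K)" using K preimage_finite[OF h] by (auto simp: subhypergraph_def finite_subset)
  then have v0: "0 < real (card (hverts K))" using K by (simp add: card_gt_0_iff)
  have "(2 * real d - 1) * real (card (hverts K)) \<le> c * real (card (hedges K))"
    using dense_part[OF le] by (simp add: K_def B'_def c_def)
  then have "(2 * real d - 1) / c \<le> edge_density K"
    using c0 v0 by (simp add: edge_density_def field_simps)
  also have "\<dots> \<le> max_density h" by fact
  finally have m: "(2 * real d - 1) / c \<le> max_density h" .
  have p: "0 < (2 * real d - 1) / c" using c0 assms(1) by simp
  have "1 / max_density h \<le> 1 / ((2 * real d - 1) / c)"
    using m p by (intro divide_left_mono mult_pos_pos) auto
  also have "\<dots> = c / (2 * real d - 1)" by simp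
  finally have "real d - 1 - c / (2 * real d - 1) \<le> real d - 1 - 1 / max_density h" by simp
  moreover have "real d - 1 - c / (2 * real d - 1) = (2 * real d - 4) / (2 * real d - 1)"
    using assms(1) by (simp add: c_def field_simps)
  ultimately show ?thesis by simp
qed

end
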